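(* Let $G$ be a finite simple connected graph with diameter at least $3$. Then $e(G^3) \ge \frac{7}{8}\, \delta(G)\, v(G)$.
   Context: All graphs are simple. For a graph $G$, $v(G)$ and $e(G)$ denote its numbers of vertices and edges respectively, and $\delta(G)$ denotes its minimum degree. For a positive integer $k$, the $k$-th power $G^k$ is the simple graph with vertex set $V(G)$ in which two distinct vertices are adjacent if and only if their distance in $G$ is at most $k$. The diameter of a connected graph is the maximum distance between a pair of its vertices. *)

theory Defs
  imports "Graph_Theory.Graph_Theory"
begin

text \<open>
  A finite simple graph is a symmetric, loop-free, finite \<open>pair_graph\<close> of the \<open>Graph_Theory\<close>
  entry: each undirected edge uv is represented by the two arcs (u,v) and (v,u).  The number of
  edges therefore counts unordered pairs, not arcs, and the degree of a vertex is its out-degree.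
\<close>

definition num_verts :: "'a pair_pre_digraph \<Rightarrow> nat" where
  "num_verts G = card (pverts G)"

definition num_edges :: "'a pair_pre_digraph \<Rightarrow> nat" where
  "num_edges G = card ((\<lambda>(u, v). {u, v}) ` parcs G)"

definition min_degree :: "'a pair_pre_digraph \<Rightarrow> nat" where
  "min_degree G = Min (out_degree (with_proj G) ` pverts G)"

text \<open>
  The graph distance is the library's shortest path length with every arc having weight 1;
  it is \<open>\<infinity>\<close> if there is no walk between the two vertices.
\<close>

definition graph_dist :: "'a pair_pre_digraph \<Rightarrow> 'a \<Rightarrow> 'a \<Rightarrow> ereal" where
  "graph_dist G u v = wf_digraph.\<mu> (with_proj G) (\<lambda>_. 1) u v"

definition diameter :: "'a pair_pre_digraph \<Rightarrow> ereal" where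
  "diameter G = Max {graph_dist G u v | u v. u \<in> pverts G \<and> v \<in> pverts G}"

definition graph_power :: "'a pair_pre_digraph \<Rightarrow> nat \<Rightarrow> 'a pair_pre_digraph" where
  "graph_power G k =
    \<lparr> pverts = pverts G,
      parcs = {(u, v). u \<in> pverts G \<and> v \<in> pverts G \<and> u \<noteq> v \<and> graph_dist G u v \<le> ereal (real k)} \<rparr>"

end

theory Submission
  imports Defs
begin

text \<open>
  Write \<open>d\<close> for the minimum degree and call a vertex low if its degree in the cube of the
  graph is less than \<open>2 * d\<close>; its deficit is the missing amount.  Since the average of the cube
  degrees has to be at least \<open>7/4 * d\<close>, the claim is that the deficits of the low vertices add
  up to at most \<open>d/4\<close> per vertex of the graph.

  If a vertex sees two vertices at distance at least 3 from each other within its ball of radius 2,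
  then the disjoint closed neighbourhoods of those two make its cube degree at least \<open>2 * d\<close>
  (lemma \<open>cube_degree_ge_far_pair\<close>).  Hence any two vertices within distance 2 of a low
  vertex are within distance 2 of each other.

  Let \<open>v\<close> be low with deficit \<open>y\<close>.  As the diameter is at least 3, some edge \<open>bc\<close> leaves
  the ball of radius 2 around \<open>v\<close>.  A vertex of that ball which equals \<open>b\<close> or is adjacent to
  it has \<open>v\<close> and \<open>c\<close> within distance 2, so it is not low.  Counting inside the ball of radius 3
  gives two facts (lemma \<open>low_vertex_structure\<close>).  The neighbourhoods of \<open>v\<close> and \<open>b\<close>
  have at least \<open>y\<close> common elements, so \<open>v\<close> has at least \<open>y\<close> neighbours that are not low.
  The low vertices within distance 2 of \<open>v\<close> lie outside the closed neighbourhood of \<open>b\<close>, so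
  there are at most \<open>d - y\<close> of them.

  The second fact shows that if a vertex \<open>w\<close> which is not low has \<open>k\<close> low neighbours, then
  each of them has deficit at most \<open>d - k\<close>, so together at most \<open>k * (d - k) \<le> d\<^sup>2 / 4\<close>.
  By the first fact, the sum of all squares \<open>y\<^sup>2\<close> is at most the sum of these totals over all
  \<open>w\<close>.  The inequality \<open>d * y \<le> d\<^sup>2 / 4 + y\<^sup>2\<close> for each low vertex then spreads
  \<open>d\<close> times the total deficit over all vertices, low or not, with \<open>d\<^sup>2 / 4\<close> for each
  (lemma \<open>sum_deficit_le\<close>).
\<close>

section \<open>Balls and neighbourhoods\<close>

locale connected_simple_graph =
  fixes V :: "'a set" and E :: "('a \<times> 'a) set" and d :: nat
  assumes finite_V: "finite V"
    and edges_in_V: "E \<subseteq> V \<times> V"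
    and sym_E: "sym E"
    and irrefl_E: "irrefl E"
    and connected_E: "u \<in> V \<Longrightarrow> v \<in> V \<Longrightarrow> (u, v) \<in> E\<^sup>*"
    and degree_ge: "v \<in> V \<Longrightarrow> d \<le> card (E `` {v})"
begin

definition nbhd :: "'a \<Rightarrow> 'a set" where
  "nbhd v = E `` {v}"

definition gball :: "nat \<Rightarrow> 'a \<Rightarrow> 'a set" where
  "gball k v = ((E\<^sup>=) ^^ k) `` {v}"

definition cube_degree :: "'a \<Rightarrow> nat" where
  "cube_degree v = card (gball 3 v - {v})"

definition low :: "'a set" where
  "low = {v \<in> V. cube_degree v < 2 * d}"

lemma nbhd_sym: "w \<in> nbhd v \<longleftrightarrow> v \<in> nbhd w"
  using sym_E by (auto simp: nbhd_def dest: symD)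

lemma not_in_own_nbhd: "v \<notin> nbhd v"
  using irrefl_E by (auto simp: nbhd_def irrefl_def)

lemma nbhd_subset_V: "nbhd v \<subseteq> V"
  using edges_in_V by (auto simp: nbhd_def)

lemma finite_nbhd: "finite (nbhd v)"
  using nbhd_subset_V finite_V by (rule finite_subset)

lemma gball_trans: "u \<in> gball j v \<Longrightarrow> w \<in> gball k u \<Longrightarrow> w \<in> gball (j + k) v"
  by (auto simp: gball_def relpow_add)

lemma nbhd_subset_gball_1: "nbhd v \<subseteq> gball 1 v"
  by (auto simp: gball_def nbhd_def)

lemma center_in_gball: "v \<in> gball k v"
proof -
  have "(v, v) \<in> (E\<^sup>=) ^^ k"
    by (induction k) auto
  then show ?thesis by (simp add: gball_def)
qed

lemma gball_mono: "j \<le> k \<Longrightarrow> gball j v \<subseteq> gball k v"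
  using gball_trans[OF _ center_in_gball, of _ j v "k - j"] by auto

lemma gball_sym: "w \<in> gball k v \<longleftrightarrow> v \<in> gball k w"
proof -
  have "sym ((E\<^sup>=) ^^ k)"
    using sym_E
  proof (induction k)
    case (Suc k)
    show ?case
    proof (rule symI)
      fix a b assume "(a, b) \<in> (E\<^sup>=) ^^ Suc k"
      then obtain w where "(a, w) \<in> (E\<^sup>=) ^^ k" "(w, b) \<in> E\<^sup>=" by (rule relpow_Suc_E)
      then have "(b, w) \<in> E\<^sup>=" "(w, a) \<in> (E\<^sup>=) ^^ k"
        using Suc by (blast dest: symD)+
      then show "(b, a) \<in> (E\<^sup>=) ^^ Suc k" by (rule relpow_Suc_I2)
    qed
  qed (auto simp: sym_def)
  then show ?thesis by (auto simp: gball_def dest: symD)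
qed

lemma gball_step: "u \<in> gball k v \<Longrightarrow> w \<in> nbhd u \<Longrightarrow> w \<in> gball (Suc k) v"
  using gball_trans[of u k v w 1] nbhd_subset_gball_1 by auto

lemma nbhd_two_steps: "u \<in> nbhd v \<Longrightarrow> w \<in> nbhd u \<Longrightarrow> w \<in> gball 2 v"
  using gball_step[of u 1 v w] nbhd_subset_gball_1[of v] by (auto simp: numeral_2_eq_2)

lemma gball_subset_V:
  assumes "v \<in> V" shows "gball k v \<subseteq> V"
proof -
  have "w \<in> V" if "(v, w) \<in> (E\<^sup>=) ^^ k" for w
    using that edges_in_V assms by (induction k arbitrary: w) auto
  then show ?thesis by (auto simp: gball_def)
qed

lemma finite_gball: "v \<in> V \<Longrightarrow> finite (gball k v)"
  using gball_subset_V finite_V finite_subset by blast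

lemma card_gball_3: "v \<in> V \<Longrightarrow> card (gball 3 v) = cube_degree v + 1"
  using card_Suc_Diff1[OF finite_gball center_in_gball, of v 3] by (simp add: cube_degree_def)

text \<open>
  The closed neighbourhoods of two vertices at distance at least 3 are disjoint, and if both
  vertices lie within distance 2 of \<open>v\<close>, their closed neighbourhoods both lie in the ball of
  radius 3.
\<close>
lemma cube_degree_ge_far_pair:
  assumes v: "v \<in> V" and x: "x \<in> gball 2 v" and y: "y \<in> gball 2 v"
    and far: "y \<notin> gball 2 x"
  shows "2 * d < cube_degree v"
proof -
  have xV: "x \<in> V" and yV: "y \<in> V"
    using gball_subset_V[OF v] x y by blast+
  let ?A = "insert x (nbhd x)" and ?B = "insert y (nbhd y)"
  have disj: "?A \<inter> ?B = {}"
  proof -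
    have "y \<noteq> x" "y \<notin> nbhd x"
      using far center_in_gball gball_mono[of 1 2 x] nbhd_subset_gball_1[of x] by auto
    moreover have False if "z \<in> nbhd x" "z \<in> nbhd y" for z
      using nbhd_two_steps[of z x y] that far nbhd_sym by blast
    ultimately show ?thesis using nbhd_sym[of x y] by blast
  qed
  have sub: "?A \<union> ?B \<subseteq> gball 3 v"
    using x y gball_step[of _ 2 v] gball_mono[of 2 3 v] by (auto simp: numeral_3_eq_3 numeral_2_eq_2)
  have "2 * d + 2 \<le> card ?A + card ?B"
    using degree_ge[OF xV] degree_ge[OF yV] not_in_own_nbhd[of x] not_in_own_nbhd[of y]
      finite_nbhd[of x] finite_nbhd[of y] by (simp add: nbhd_def)
  also have "\<dots> = card (?A \<union> ?B)"
    using disj finite_nbhd by (subst card_Un_disjoint) auto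
  also have "\<dots> \<le> card (gball 3 v)"
    using sub finite_gball[OF v] by (intro card_mono)
  also have "\<dots> = cube_degree v + 1"
    using v by (rule card_gball_3)
  finally show ?thesis by simp
qed

section \<open>The surroundings of a vertex of low cube degree\<close>

lemma low_gball_2_close:
  "v \<in> low \<Longrightarrow> x \<in> gball 2 v \<Longrightarrow> y \<in> gball 2 v \<Longrightarrow> y \<in> gball 2 x"
  using cube_degree_ge_far_pair[of v x y] by (fastforce simp: low_def)

text \<open>
  If no edge left the ball of radius 2 around a low vertex, the ball would contain all vertices,
  and then no two vertices would be at distance greater than 2.
\<close>
lemma edge_leaving_gball_2:
  assumes v: "v \<in> low" and diam: "p \<in> V" "q \<in> V" "q \<notin> gball 2 p"
  obtains b c where "b \<in> gball 2 v" "c \<in> nbhd b" "c \<notin> gball 2 v"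
proof -
  have vV: "v \<in> V" using v by (simp add: low_def)
  have "\<not> V \<subseteq> gball 2 v"
    using low_gball_2_close[OF v] diam by blast
  then obtain z where z: "z \<in> V" "z \<notin> gball 2 v" by blast
  have "\<exists>b c. b \<in> gball 2 v \<and> (b, c) \<in> E \<and> c \<notin> gball 2 v"
  proof (rule ccontr)
    assume "\<not> ?thesis"
    then have closed: "\<And>b c. b \<in> gball 2 v \<Longrightarrow> (b, c) \<in> E \<Longrightarrow> c \<in> gball 2 v" by blast
    have "(v, z) \<in> E\<^sup>*" using connected_E vV z by blast
    then have "z \<in> gball 2 v"
      by induction (auto intro: center_in_gball closed)
    then show False using z by blast
  qed
  then show ?thesis using that by (auto simp: nbhd_def)
qed

text \<open>
  Both bounds come from one edge \<open>bc\<close> leaving the ball of radius 2 around \<open>v\<close>: no vertex of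
  this ball is low if it belongs to the closed neighbourhood of \<open>b\<close>, which itself lies in the
  ball of radius 3.  The first bound is inclusion and exclusion for the neighbourhoods of \<open>v\<close>
  and \<open>b\<close>; the second places the low vertices near \<open>v\<close> beside the closed neighbourhood
  of \<open>b\<close>.
\<close>
lemma low_vertex_structure:
  assumes v: "v \<in> low" and diam: "p \<in> V" "q \<in> V" "q \<notin> gball 2 p"
  shows "2 * d \<le> cube_degree v + card (nbhd v - low)"
    and "card (low \<inter> gball 2 v) + d \<le> cube_degree v"
proof -
  have vV: "v \<in> V" using v by (simp add: low_def)
  obtain b c where b: "b \<in> gball 2 v" and c: "c \<in> nbhd b" and out: "c \<notin> gball 2 v"
    using edge_leaving_gball_2[OF assms] .
  have bV: "b \<in> V" using gball_subset_V[OF vV] b by blast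
  have v_not: "v \<notin> nbhd b"
    using out c nbhd_two_steps[of b v c] nbhd_sym[of b v] by auto
  have nb: "nbhd b \<subseteq> gball 3 v"
    using b gball_step[of b 2 v] by (auto simp: numeral_3_eq_3 numeral_2_eq_2)
  have nv: "nbhd v \<subseteq> gball 3 v"
    using nbhd_subset_gball_1[of v] gball_mono[of 1 3 v] by auto
  have b3: "gball 2 v \<subseteq> gball 3 v" by (rule gball_mono) simp
  have fin: "finite (gball 3 v)" using finite_gball[OF vV] .
  \<comment> \<open>Such a \<open>u\<close> has both \<open>v\<close> and \<open>c\<close> within distance 2, but these two are further apart.\<close>
  have no_low: "u \<notin> low" if "u \<in> insert b (nbhd b)" "u \<in> gball 2 v" for u
  proof
    assume u: "u \<in> low"
    have "c \<in> gball 2 u"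
    proof (cases "u = b")
      case True
      then show ?thesis
        using c nbhd_subset_gball_1[of b] gball_mono[of 1 2 b] by auto
    next
      case False
      then have "b \<in> nbhd u" using that nbhd_sym[of u b] by simp
      then show ?thesis using c by (rule nbhd_two_steps)
    qed
    moreover have "v \<in> gball 2 u" using that(2) gball_sym by blast
    ultimately show False using low_gball_2_close[OF u] out by blast
  qed
  have "nbhd v \<inter> nbhd b \<subseteq> nbhd v - low"
    using no_low nbhd_subset_gball_1[of v] gball_mono[of 1 2 v] by auto
  then have "card (nbhd v \<inter> nbhd b) \<le> card (nbhd v - low)"
    using finite_nbhd by (intro card_mono) auto
  moreover have "card (nbhd v \<union> nbhd b) \<le> cube_degree v"
    unfolding cube_degree_def using nb nv v_not not_in_own_nbhd fin by (intro card_mono) auto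
  moreover have "card (nbhd v) + card (nbhd b) = card (nbhd v \<union> nbhd b) + card (nbhd v \<inter> nbhd b)"
    using finite_nbhd by (intro card_Un_Int)
  ultimately show "2 * d \<le> cube_degree v + card (nbhd v - low)"
    using degree_ge[OF vV] degree_ge[OF bV] by (simp add: nbhd_def)
  have disj: "(low \<inter> gball 2 v) \<inter> insert b (nbhd b) = {}"
    using no_low by blast
  have "card (low \<inter> gball 2 v) + (d + 1) \<le> card (low \<inter> gball 2 v) + card (insert b (nbhd b))"
    using degree_ge[OF bV] finite_nbhd[of b] not_in_own_nbhd[of b] by (simp add: nbhd_def)
  also have "\<dots> = card ((low \<inter> gball 2 v) \<union> insert b (nbhd b))"
    using disj finite_nbhd finite_gball[OF vV] by (intro card_Un_disjoint[symmetric]) auto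
  also have "\<dots> \<le> card (gball 3 v)"
    using fin nb b b3 by (intro card_mono) auto
  also have "\<dots> = cube_degree v + 1"
    using vV by (rule card_gball_3)
  finally show "card (low \<inter> gball 2 v) + d \<le> cube_degree v" by simp
qed

section \<open>Summing the deficits\<close>

lemma four_mult_le_square: "4 * (x * (s - x)) \<le> (s::real)\<^sup>2"
  using zero_le_power2[of "s - 2 * x"] by (simp add: power2_eq_square algebra_simps)

text \<open>
  Each low vertex \<open>v\<close> with deficit \<open>y v\<close> places weight \<open>y v\<close> on every neighbour that is
  not low.  It has at least \<open>y v\<close> such neighbours, so the total weight is at least the sum
  of the squared deficits, while no vertex receives more than \<open>d\<^sup>2 / 4\<close>, because a vertex
  with many low neighbours forces each of them to have a small deficit.
\<close>
lemma sum_deficit_le: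
  assumes diam: "p \<in> V" "q \<in> V" "q \<notin> gball 2 p"
  shows "4 * (\<Sum>v\<in>low. 2 * real d - real (cube_degree v)) \<le> real d * real (card V)"
proof -
  define y where "y v = 2 * real d - real (cube_degree v)" for v
  note struct = low_vertex_structure[OF _ diam]
  have fin_low: "finite low" and low_V: "low \<subseteq> V" using finite_V by (auto simp: low_def)
  have y_pos: "0 \<le> y v" if "v \<in> low" for v using that by (simp add: low_def y_def)
  have y_common: "y v \<le> real (card (nbhd v - low))" if "v \<in> low" for v
    using struct(1)[OF that] by (simp add: y_def)
  have y_crowd: "y v \<le> real d - real (card (low \<inter> nbhd w))" if "v \<in> low \<inter> nbhd w" for v w
  proof -
    have "low \<inter> nbhd w \<subseteq> low \<inter> gball 2 v"
      using that nbhd_two_steps[of w v] nbhd_sym[of v w] by auto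
    then have "card (low \<inter> nbhd w) \<le> card (low \<inter> gball 2 v)"
      using fin_low by (intro card_mono) auto
    then show ?thesis using struct(2)[of v] that by (simp add: y_def)
  qed
  have "4 * (\<Sum>v\<in>low. (y v)\<^sup>2) \<le> 4 * (\<Sum>v\<in>low. \<Sum>w\<in>nbhd v - low. y v)"
    using y_common y_pos
    by (intro mult_left_mono sum_mono) (auto simp: power2_eq_square intro: mult_right_mono)
  also have "(\<Sum>v\<in>low. \<Sum>w\<in>nbhd v - low. y v)
      = (\<Sum>v\<in>low. \<Sum>w | w \<in> V - low \<and> w \<in> nbhd v. y v)"
    using nbhd_subset_V by (intro sum.cong) auto
  also have "\<dots> = (\<Sum>w\<in>V - low. \<Sum>v | v \<in> low \<and> w \<in> nbhd v. y v)"
    using finite_V fin_low by (intro sum.swap_restrict) auto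
  also have "\<dots> = (\<Sum>w\<in>V - low. \<Sum>v\<in>low \<inter> nbhd w. y v)"
    using nbhd_sym by (intro sum.cong) auto
  also have "\<dots> \<le> (\<Sum>w\<in>V - low. \<Sum>v\<in>low \<inter> nbhd w. real d - real (card (low \<inter> nbhd w)))"
    using y_crowd by (intro sum_mono) auto
  also have "4 * \<dots> = (\<Sum>w\<in>V - low. 4 * (real (card (low \<inter> nbhd w))
      * (real d - real (card (low \<inter> nbhd w)))))"
    by (simp add: sum_distrib_left)
  also have "\<dots> \<le> (\<Sum>w\<in>V - low. (real d)\<^sup>2)"
    by (intro sum_mono four_mult_le_square)
  finally have squares: "4 * (\<Sum>v\<in>low. (y v)\<^sup>2) \<le> (\<Sum>w\<in>V - low. (real d)\<^sup>2)" by simp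
  \<comment> \<open>Trade each deficit for its square, at the cost of \<open>d\<^sup>2 / 4\<close> per low vertex.\<close>
  have "real d * (4 * (\<Sum>v\<in>low. y v)) = (\<Sum>v\<in>low. 4 * (y v * (real d - y v)) + 4 * (y v)\<^sup>2)"
    by (simp add: sum_distrib_left power2_eq_square algebra_simps)
  also have "\<dots> \<le> (\<Sum>v\<in>low. (real d)\<^sup>2 + 4 * (y v)\<^sup>2)"
    by (intro sum_mono add_right_mono four_mult_le_square)
  also have "\<dots> \<le> (\<Sum>v\<in>low. (real d)\<^sup>2) + (\<Sum>w\<in>V - low. (real d)\<^sup>2)"
    using squares by (simp add: sum.distrib sum_distrib_left)
  also have "\<dots> = (\<Sum>w\<in>V. (real d)\<^sup>2)"
    using sum.subset_diff[OF low_V finite_V, of "\<lambda>_. (real d)\<^sup>2"] by linarith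
  also have "\<dots> = real d * (real d * real (card V))"
    by (simp add: power2_eq_square)
  finally have *: "real d * (4 * (\<Sum>v\<in>low. y v)) \<le> real d * (real d * real (card V))" .
  show ?thesis
  proof (cases "d = 0")
    case True
    then have "low = {}" unfolding low_def by simp
    then show ?thesis by simp
  next
    case False
    then show ?thesis using * by (simp add: y_def)
  qed
qed

lemma sum_cube_degree_ge:
  assumes diam: "p \<in> V" "q \<in> V" "q \<notin> gball 2 p"
  shows "7 * real d * real (card V) \<le> 4 * real (\<Sum>v\<in>V. cube_degree v)"
proof -
  have "2 * real d * real (card V) - real (\<Sum>v\<in>V. cube_degree v)
      = (\<Sum>v\<in>V. 2 * real d - real (cube_degree v))"
    by (simp add: sum_subtractf)
  also have "\<dots> \<le> (\<Sum>v\<in>low. 2 * real d - real (cube_degree v))"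
  proof -
    have "(\<Sum>v\<in>V - low. 2 * real d - real (cube_degree v)) \<le> 0"
      by (intro sum_nonpos) (auto simp: low_def)
    moreover have "low \<subseteq> V" by (auto simp: low_def)
    ultimately show ?thesis
      using sum.subset_diff[of low V "\<lambda>v. 2 * real d - real (cube_degree v)"] finite_V by simp
  qed
  finally show ?thesis using sum_deficit_le[OF diam] by simp
qed

end

section \<open>Graph distance and edge counting\<close>

lemma (in pair_wf_digraph) awalk_length_iff_relpow:
  assumes "u \<in> pverts G"
  shows "(\<exists>p. awalk u p v \<and> length p \<le> k) \<longleftrightarrow> (u, v) \<in> ((parcs G)\<^sup>=) ^^ k"
  using assms
proof (induction k arbitrary: u)
  case 0
  then show ?case by (auto simp: awalk_Nil_iff)
next
  case (Suc k)
  show ?case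
  proof
    assume "\<exists>p. awalk u p v \<and> length p \<le> Suc k"
    then obtain p where p: "awalk u p v" "length p \<le> Suc k" by blast
    show "(u, v) \<in> ((parcs G)\<^sup>=) ^^ Suc k"
    proof (cases p)
      case Nil
      then have "awalk u [] v" "length ([] :: ('a \<times> 'a) list) \<le> k" using p by auto
      then have "(u, v) \<in> ((parcs G)\<^sup>=) ^^ k" using Suc by blast
      then show ?thesis by (intro relpow_Suc_I2[of u u]) auto
    next
      case (Cons e es)
      then have e: "e \<in> parcs G" "fst e = u" "awalk (snd e) es v" "length es \<le> k"
        using p by (auto simp: awalk_Cons_iff)
      then have "(snd e, v) \<in> ((parcs G)\<^sup>=) ^^ k"
        using Suc.IH[of "snd e"] arc_snd_in_verts by blast
      moreover have "(u, snd e) \<in> (parcs G)\<^sup>=" using e by auto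
      ultimately show ?thesis by (intro relpow_Suc_I2)
    qed
  next
    assume "(u, v) \<in> ((parcs G)\<^sup>=) ^^ Suc k"
    then obtain w where w: "(u, w) \<in> (parcs G)\<^sup>=" "(w, v) \<in> ((parcs G)\<^sup>=) ^^ k"
      by (blast dest: relpow_Suc_D2)
    then have "w \<in> pverts G" using Suc.prems by (auto dest: in_arcsD2)
    then obtain p where p: "awalk w p v" "length p \<le> k" using Suc.IH w by blast
    show "\<exists>p. awalk u p v \<and> length p \<le> Suc k"
    proof (cases "u = w")
      case True
      then show ?thesis using p by auto
    next
      case False
      then have "awalk u ((u, w) # p) v" using p w by (auto simp: awalk_Cons_iff)
      then show ?thesis using p by (intro exI[of _ "(u, w) # p"]) auto
    qed
  qed
qed

text \<open>
  The distance is an infimum of natural numbers, so a bound \<open>k\<close> on it is already met by some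
  walk: otherwise all walks would have length at least \<open>k + 1\<close>.
\<close>
lemma (in pair_wf_digraph) graph_dist_le_iff:
  assumes "u \<in> pverts G"
  shows "graph_dist G u v \<le> ereal (real k) \<longleftrightarrow> (u, v) \<in> ((parcs G)\<^sup>=) ^^ k"
proof -
  have cost: "awalk_cost (\<lambda>_. 1) p = real (length p)" for p :: "('a \<times> 'a) list"
    by (induction p) auto
  have dist: "graph_dist G u v = (INF p\<in>{p. awalk u p v}. ereal (real (length p)))"
    by (simp add: graph_dist_def \<mu>_def cost)
  have "graph_dist G u v \<le> ereal (real k) \<longleftrightarrow> (\<exists>p. awalk u p v \<and> length p \<le> k)"
  proof
    assume le: "graph_dist G u v \<le> ereal (real k)"
    show "\<exists>p. awalk u p v \<and> length p \<le> k"
    proof (rule ccontr)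
      assume "\<not> ?thesis"
      then have "ereal (real (Suc k)) \<le> graph_dist G u v"
        unfolding dist by (intro INF_greatest) (auto simp: not_le)
      with le have "ereal (real (Suc k)) \<le> ereal (real k)" by (rule order_trans[rotated])
      then show False by simp
    qed
  next
    assume "\<exists>p. awalk u p v \<and> length p \<le> k"
    then show "graph_dist G u v \<le> ereal (real k)"
      unfolding dist by (auto intro: INF_lower2)
  qed
  then show ?thesis using awalk_length_iff_relpow[OF assms] by simp
qed

lemma card_arcs_le_twice_edges:
  assumes "finite A"
  shows "card A \<le> 2 * card ((\<lambda>(u, v). {u, v}) ` A)"
proof -
  let ?f = "\<lambda>(u, v). {u, v}"
  have "card A = (\<Sum>e\<in>?f ` A. card {a \<in> A. ?f a = e})"
    using sum.image_gen[OF assms, of "\<lambda>_. 1::nat" ?f] by simp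
  also have "\<dots> \<le> (\<Sum>e\<in>?f ` A. 2)"
  proof (rule sum_mono)
    fix e assume "e \<in> ?f ` A"
    then obtain u v where e: "e = {u, v}" by auto
    have "{a \<in> A. ?f a = e} \<subseteq> {(u, v), (v, u)}"
    proof
      fix a assume "a \<in> {a \<in> A. ?f a = e}"
      then have "{fst a, snd a} = {u, v}" by (simp add: e case_prod_beta)
      then show "a \<in> {(u, v), (v, u)}" by (cases a) (simp add: doubleton_eq_iff)
    qed
    then have "card {a \<in> A. ?f a = e} \<le> card {(u, v), (v, u)}" by (intro card_mono) auto
    also have "\<dots> \<le> 2" by (cases "u = v") auto
    finally show "card {a \<in> A. ?f a = e} \<le> 2" .
  qed
  finally show ?thesis by simp
qed

section \<open>The edge count of the cube\<close>

theorem theorem1p3: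
  fixes G :: "'a pair_pre_digraph"
  assumes "pair_graph G"
    and "Digraph_Component.connected (with_proj G)"
    and "diameter G \<ge> 3"
  shows "real (num_edges (graph_power G 3)) \<ge> 7 / 8 * real (min_degree G) * real (num_verts G)"
proof -
  interpret pair_graph G by fact
  have strong: "strongly_connected (with_proj G)"
    using symmetric_connected_imp_strongly_connected[OF pair_sym_arcs assms(2)] .
  have nonempty: "pverts G \<noteq> {}" using strong by (simp add: strongly_connected_def)
  have fin: "finite (pverts G)" by (rule pair_finite_verts)
  have out: "out_degree (with_proj G) v = card (parcs G `` {v})" for v
  proof -
    have "out_arcs (with_proj G) v = Pair v ` (parcs G `` {v})"
      by (auto simp: out_arcs_def)
    then show ?thesis by (simp add: out_degree_def card_image inj_on_def)
  qed
  interpret C: connected_simple_graph "pverts G" "parcs G" "min_degree G"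
  proof
    show "finite (pverts G)" by (rule fin)
    show "parcs G \<subseteq> pverts G \<times> pverts G" by (auto dest: in_arcsD1 in_arcsD2)
    show "sym (parcs G)" using pair_sym_arcs by (simp add: symmetric_def)
    show "irrefl (parcs G)" using pair_no_loops by (fastforce simp: irrefl_def)
    show "(u, v) \<in> (parcs G)\<^sup>*" if "u \<in> pverts G" "v \<in> pverts G" for u v
    proof -
      have "u \<rightarrow>\<^sup>*\<^bsub>with_proj G\<^esub> v" using strong that by (auto simp: strongly_connected_def)
      then show ?thesis
        unfolding reachable_def by (auto dest: rtrancl_on_rtranclI)
    qed
    show "min_degree G \<le> card (parcs G `` {v})" if "v \<in> pverts G" for v
      using that fin by (auto simp: min_degree_def out[symmetric])
  qed
  let ?D = "{graph_dist G u v | u v. u \<in> pverts G \<and> v \<in> pverts G}"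
  have "?D = (\<lambda>(u, v). graph_dist G u v) ` (pverts G \<times> pverts G)" by auto
  then have "finite ?D" "?D \<noteq> {}" using fin nonempty by auto
  then have "diameter G \<in> ?D" unfolding diameter_def by (rule Max_in)
  then obtain p q where pq: "p \<in> pverts G" "q \<in> pverts G" "graph_dist G p q \<ge> 3"
    using assms(3) by auto
  have "\<not> graph_dist G p q \<le> ereal (real 2)"
  proof
    assume "graph_dist G p q \<le> ereal (real 2)"
    with pq(3) have "(3::ereal) \<le> ereal (real 2)" by (rule order_trans)
    then show False by simp
  qed
  then have far: "q \<notin> C.gball 2 p"
    using graph_dist_le_iff[OF pq(1), of q 2] by (auto simp: C.gball_def)
  have arcs: "parcs (graph_power G 3) = (SIGMA v:pverts G. C.gball 3 v - {v})"
  proof -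
    have dist: "graph_dist G u v \<le> ereal (real 3) \<longleftrightarrow> v \<in> C.gball 3 u" if "u \<in> pverts G" for u v
      using graph_dist_le_iff[OF that, of v 3] unfolding C.gball_def Image_singleton_iff .
    have "(u, v) \<in> parcs (graph_power G 3) \<longleftrightarrow>
        u \<in> pverts G \<and> v \<in> C.gball 3 u - {u}" for u v
    proof (cases "u \<in> pverts G")
      case True
      then show ?thesis
        using dist[OF True, of v] C.gball_subset_V[OF True, of 3] by (auto simp: graph_power_def)
    qed (simp add: graph_power_def)
    then show ?thesis by (intro set_eqI) (simp add: split_paired_all mem_Sigma_iff)
  qed
  have "(\<Sum>v\<in>pverts G. C.cube_degree v) = card (parcs (graph_power G 3))"
    unfolding arcs C.cube_degree_def using fin C.finite_gball
    by (subst card_SigmaI) auto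
  also have "\<dots> \<le> 2 * num_edges (graph_power G 3)"
    unfolding num_edges_def using fin C.finite_gball
    by (intro card_arcs_le_twice_edges) (auto simp: arcs)
  finally have "real (\<Sum>v\<in>pverts G. C.cube_degree v) \<le> 2 * real (num_edges (graph_power G 3))"
    by linarith
  then show ?thesis
    using C.sum_cube_degree_ge[OF pq(1,2) far] by (simp add: num_verts_def)
qed

end
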